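(* Let $G(k)$ be an $N\times N$ algebraic matrix function with $\det G\not\equiv 0$, with branch points at affixes $\tau_m^{+}$ ($\mathrm{Im}\,\tau_m^+>0$) and $\tau_m^-$ ($\mathrm{Im}\,\tau_m^-<0$), and let $Q^+(k)$, $Q^-(k)$ form a solution of the factorization problem $G(k)=Q^+(k)Q^-(k)$ described in the context. Then for every word $w\in\mathcal W$ the following relations hold (dependence on $k$ is implied for all functions): $$Q^+\{w\}=G\{w^+\}\,G^{-1}\{w^{+-}\}\,Q^+\{w^{+-}\},$$ $$Q^-\{w\}=Q^-\{w^{-+}\}\,G^{-1}\{w^{-+}\}\,G\{w^-\}.$$
   Context: Setting. $G(k)$ is an $N\times N$ matrix whose entries are algebraic functions of $k\in\mathbb C$. A branch of $G$ is fixed in a narrow strip $-\epsilon<\mathrm{Im}\,k<\epsilon$ along the real axis. The branch points of $G$ lie off the real axis (outside the strip); their affixes (projections to the $k$-plane) are $\tau_m^+$ with $\mathrm{Im}\,\tau_m^+>0$ and $\tau_m^-$ with $\mathrm{Im}\,\tau_m^-<0$. Factorization problem. A solution is a pair of matrices $Q^+(k)$, $Q^-(k)$ such that $Q^+$ is analytic (except possibly for some isolated poles), continuous and of algebraic growth in the upper half-plane $\mathrm{Im}\,k>-\epsilon$, $Q^-$ has the same properties in the lower half-plane $\mathrm{Im}\,k<\epsilon$, and $G(k)=Q^+(k)Q^-(k)$ in the strip, where $G$ is the fixed branch. Algebraic growth means that there is a number $l$ such that all matrix elements grow no faster than $|k|^l$ in the corresponding half-plane. Bypasses. Draw pairwise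 disjoint cuts $\gamma_m^+$ from $\tau_m^+$ to infinity in the upper half-plane and $\gamma_m^-$ from $\tau_m^-$ to infinity in the lower half-plane, none meeting the real axis. The branch of $G$ on the cut plane extending the fixed branch on the strip is called the physical sheet. The letter $a_i$ denotes a bypass about $\tau_i^+$ in the positive direction: a closed path based at a point $k$ of the strip, lying in $\mathrm{Im}\,k>-\epsilon$, crossing $\gamma_i^+$ once and no other cut. The letter $b_i$ similarly denotes a bypass about $\tau_i^-$ in the positive direction, lying in $\mathrm{Im}\,k<\epsilon$ and crossing only $\gamma_i^-$. A word in these letters denotes the consecutive bypasses, read from left to right (leftmost performed first); $e$ is the trivial (empty) word. $\mathcal W$ is the set of all words, and $\mathcal W_a$, $\mathcal W_b$ are the sets of words composed only of letters $a_i$, respectively only of letters $b_i$. For a function $F$ ($F=G,Q^+,Q^-$), $F(k)\{w\}$ is the value at $k$ obtained by analytic continuation of $F$ along $w$ starting from its original (physical) value $F(k)\{e\}$; $G^{-1}\{w\}$ is the inverse of $G\{w\}$. Identities are understood as identities between meromorphic matrix functions. Truncation operators. For $w=\alpha_1\alpha_2\cdots\alpha_n$ with each $\alpha_i$ a single letter, let $p$ be the maximal number such that $\alpha_1\cdots\alpha_p\in\mathcal W_a$ and $m$ the maximal number such that $\alpha_1\cdots\alpha_m\in\mathcal W_b$ (either may be $0$). Then $w^+=\alpha_{p+1}\cdots\alpha_n$ and $w^-=\alpha_{m+1}\cdots\alpha_n$. That is, $^+$ removes the longest prefix of letters $a_i$ and $^-$ removes the longest prefix of letters $b_i$. Also $w^{+-}=(w^+)^-$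 and $w^{-+}=(w^-)^+$. *)

theory Defs
  imports
    "HOL-Complex_Analysis.Complex_Analysis"
    "HOL-Computational_Algebra.Polynomial"
begin

section \<open>Meromorphic matrix functions and their germs\<close>

type_synonym 'n matfun = "complex \<Rightarrow> complex^'n^'n"

definition mat_meromorphic_on :: "('n::finite) matfun \<Rightarrow> complex set \<Rightarrow> bool" where
  "mat_meromorphic_on F A \<longleftrightarrow> (\<forall>i j. (\<lambda>z. F z $ i $ j) meromorphic_on A)"

text \<open>
  Every point is either a point of analyticity or a genuine pole; by meromorphy the poles are
  isolated. Unlike bare \<^const>\<open>meromorphic_on\<close>, this excludes exceptional points at which the
  function merely has a wrong value, so the function is continuous off its poles.
\<close>
definition analytic_except_poles :: "(complex \<Rightarrow> complex) \<Rightarrow> complex set \<Rightarrow> bool" where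
  "analytic_except_poles f A \<longleftrightarrow>
     f meromorphic_on A \<and> (\<forall>z\<in>A. f analytic_on {z} \<or> is_pole f z)"

definition mat_analytic_except_poles :: "('n::finite) matfun \<Rightarrow> complex set \<Rightarrow> bool" where
  "mat_analytic_except_poles F A \<longleftrightarrow> (\<forall>i j. analytic_except_poles (\<lambda>z. F z $ i $ j) A)"

text \<open>
  Equality of meromorphic functions near \<open>k\<close>. The point \<open>k\<close> itself is left out because it may be
  a pole.
\<close>
definition germ_eq :: "complex \<Rightarrow> ('n::finite) matfun \<Rightarrow> 'n matfun \<Rightarrow> bool" where
  "germ_eq k F H \<longleftrightarrow> (\<forall>\<^sub>F z in at k. F z = H z)"

section \<open>Analytic continuation along paths\<close>

text \<open>
  The germ of \<open>H\<close> at the end of \<open>\<gamma>\<close> arises from the germ of \<open>F\<close> at its start by meromorphic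
  continuation: \<open>\<Phi> t\<close> represents the germ at \<open>\<gamma> t\<close>, and nearby germs are compatible.
\<close>
definition continues_along ::
    "(real \<Rightarrow> complex) \<Rightarrow> ('n::finite) matfun \<Rightarrow> 'n matfun \<Rightarrow> bool" where
  "continues_along \<gamma> F H \<longleftrightarrow>
     (\<exists>\<Phi>. (\<forall>t\<in>{0..1}. mat_meromorphic_on (\<Phi> t) {\<gamma> t}) \<and>
          (\<forall>t\<in>{0..1}. \<forall>\<^sub>F s in at t within {0..1}. germ_eq (\<gamma> s) (\<Phi> s) (\<Phi> t)) \<and>
          germ_eq (\<gamma> 0) (\<Phi> 0) F \<and> germ_eq (\<gamma> 1) (\<Phi> 1) H)"

definition continuable :: "(real \<Rightarrow> complex) \<Rightarrow> ('n::finite) matfun \<Rightarrow> bool" where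
  "continuable \<gamma> F \<longleftrightarrow> (\<exists>H. continues_along \<gamma> F H)"

text \<open>
  By the identity theorem the result of a continuation is unique as a germ at the endpoint, so
  the choice only picks a representative. It is meaningful only if \<open>F\<close> is continuable.
\<close>
definition continuation :: "(real \<Rightarrow> complex) \<Rightarrow> ('n::finite) matfun \<Rightarrow> 'n matfun" where
  "continuation \<gamma> F = (SOME H. continues_along \<gamma> F H)"

section \<open>The strip, the factorization problem, algebraic functions\<close>

definition strip :: "real \<Rightarrow> complex set" where
  "strip \<epsilon> = {k. -\<epsilon> < Im k \<and> Im k < \<epsilon>}"

definition upper_half :: "real \<Rightarrow> complex set" where
  "upper_half \<epsilon> = {k. Im k > -\<epsilon>}"

definition lower_half :: "real \<Rightarrow> complex set" where
  "lower_half \<epsilon> = {k. Im k < \<epsilon>}"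

definition algebraic_growth :: "('n::finite) matfun \<Rightarrow> complex set \<Rightarrow> bool" where
  "algebraic_growth F A \<longleftrightarrow>
     (\<exists>(l::real) C. \<forall>i j. \<forall>\<^sub>F k in inf at_infinity (principal A).
        norm (F k $ i $ j) \<le> C * norm k powr l)"

definition factorization_solution ::
    "real \<Rightarrow> ('n::finite) matfun \<Rightarrow> 'n matfun \<Rightarrow> 'n matfun \<Rightarrow> bool" where
  "factorization_solution \<epsilon> G Qp Qm \<longleftrightarrow>
     mat_analytic_except_poles Qp (upper_half \<epsilon>) \<and> algebraic_growth Qp (upper_half \<epsilon>) \<and>
     mat_analytic_except_poles Qm (lower_half \<epsilon>) \<and> algebraic_growth Qm (lower_half \<epsilon>) \<and>
     (\<forall>\<^sub>\<approx>k\<in>strip \<epsilon>. G k = Qp k ** Qm k)"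

text \<open>
  A single-valued branch, on a connected open set \<open>A\<close>, of an algebraic function:
  \<open>\<Sum>i. p\<^sub>i(k) f(k)^i = 0\<close> for some polynomials \<open>p\<^sub>i\<close>, not all zero. Here \<open>P\<close> is a polynomial in the
  value with coefficients in \<open>\<complex>[k]\<close>.
\<close>
definition algebraic_branch :: "(complex \<Rightarrow> complex) \<Rightarrow> complex set \<Rightarrow> bool" where
  "algebraic_branch f A \<longleftrightarrow>
     analytic_except_poles f A \<and>
     (\<exists>P :: complex poly poly. P \<noteq> 0 \<and> (\<forall>\<^sub>\<approx>k\<in>A. poly (poly P [:f k:]) k = 0))"

definition mat_algebraic_branch :: "('n::finite) matfun \<Rightarrow> complex set \<Rightarrow> bool" where
  "mat_algebraic_branch G A \<longleftrightarrow> (\<forall>i j. algebraic_branch (\<lambda>k. G k $ i $ j) A)"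

text \<open>
  The point \<open>p\<close> is the affix of a branch point of the multi-valued function generated by the
  branch \<open>G\<close> on \<open>A\<close> iff no disc about \<open>p\<close> has the property that all branches reached over it are
  single-valued meromorphic functions on the disc. Poles are not branch points. Branches of \<open>G\<close>
  on all sheets are taken into account, not just those on the physical sheet.
\<close>
definition branch_affix :: "complex set \<Rightarrow> ('n::finite) matfun \<Rightarrow> complex \<Rightarrow> bool" where
  "branch_affix A G p \<longleftrightarrow>
     \<not> (\<exists>r>0. \<forall>\<gamma> H. path \<gamma> \<and> pathstart \<gamma> \<in> A \<and> pathfinish \<gamma> \<in> ball p r \<and> continues_along \<gamma> G H \<longrightarrow>
          (\<exists>B. mat_meromorphic_on B (ball p r) \<and> germ_eq (pathfinish \<gamma>) B H))"

section \<open>Cuts, bypasses and words\<close>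

definition cut_to_infinity :: "complex \<Rightarrow> (real \<Rightarrow> complex) \<Rightarrow> bool" where
  "cut_to_infinity \<tau> \<gamma> \<longleftrightarrow>
     continuous_on {0..} \<gamma> \<and> inj_on \<gamma> {0..} \<and> \<gamma> 0 = \<tau> \<and> filterlim \<gamma> at_infinity at_top"

text \<open>
  A closed path in \<open>U\<close> based at \<open>k\<close>, meeting the cut \<open>C\<close> from \<open>\<tau>\<close> exactly once and missing the set
  \<open>D\<close> of the other cuts. The winding number makes the path encircle \<open>\<tau>\<close> once in the positive
  direction; it also rules out touching \<open>C\<close> without crossing it.
\<close>
definition is_bypass ::
    "complex set \<Rightarrow> complex \<Rightarrow> complex \<Rightarrow> complex set \<Rightarrow> complex set \<Rightarrow> (real \<Rightarrow> complex) \<Rightarrow> bool" where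
  "is_bypass U k \<tau> C D c \<longleftrightarrow>
     path c \<and> pathstart c = k \<and> pathfinish c = k \<and> path_image c \<subseteq> U \<and>
     (\<exists>!t. t \<in> {0..1} \<and> c t \<in> C) \<and> path_image c \<inter> D = {} \<and>
     \<tau> \<notin> path_image c \<and> winding_number c \<tau> = 1"

datatype letter = La nat | Lb nat

fun is_a :: "letter \<Rightarrow> bool" where
  "is_a (La i) = True"
| "is_a (Lb i) = False"

type_synonym word = "letter list"

definition bypass_words :: "nat \<Rightarrow> nat \<Rightarrow> word set" where
  "bypass_words Mp Mm = lists (La ` {..<Mp} \<union> Lb ` {..<Mm})"

definition trunc_plus :: "word \<Rightarrow> word" where
  "trunc_plus w = dropWhile is_a w"

definition trunc_minus :: "word \<Rightarrow> word" where
  "trunc_minus w = dropWhile (\<lambda>x. \<not> is_a x) w"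

text \<open>The leftmost letter is performed first; \<open>a i\<close>, \<open>b i\<close> are the chosen bypasses based at \<open>k\<close>.\<close>
fun word_path ::
    "complex \<Rightarrow> (nat \<Rightarrow> real \<Rightarrow> complex) \<Rightarrow> (nat \<Rightarrow> real \<Rightarrow> complex) \<Rightarrow> word \<Rightarrow> real \<Rightarrow> complex" where
  "word_path k a b [] = linepath k k"
| "word_path k a b (La i # w) = a i +++ word_path k a b w"
| "word_path k a b (Lb i # w) = b i +++ word_path k a b w"

text \<open>The function \<open>F{w}\<close> near the base point \<open>k\<close>.\<close>
definition continued ::
    "complex \<Rightarrow> (nat \<Rightarrow> real \<Rightarrow> complex) \<Rightarrow> (nat \<Rightarrow> real \<Rightarrow> complex) \<Rightarrow>
      ('n::finite) matfun \<Rightarrow> word \<Rightarrow> 'n matfun" where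
  "continued k a b F w = continuation (word_path k a b w) F"

end

theory Submission
  imports Defs
begin

text \<open>
  \<open>Q\<^sup>+\<close> is meromorphic in the upper half-plane, so a bypass \<open>a\<^sub>i\<close> returns it to its original value;
  likewise \<open>b\<^sub>i\<close> and \<open>Q\<^sup>-\<close>. Hence \<open>Q\<^sup>+{w} = Q\<^sup>+{w\<^sup>+}\<close> and \<open>Q\<^sup>-{w} = Q\<^sup>-{w\<^sup>-}\<close>. The identity \<open>G = Q\<^sup>+ Q\<^sup>-\<close>
  and the invertibility of \<open>G\<close> persist under continuation, so the two factors can be exchanged:
  \<open>Q\<^sup>+{v} = G{v} Q\<^sup>-{v}\<^sup>-\<^sup>1 = G{v} Q\<^sup>-{v\<^sup>-}\<^sup>-\<^sup>1 = G{v} G{v\<^sup>-}\<^sup>-\<^sup>1 Q\<^sup>+{v\<^sup>-}\<close> with \<open>v = w\<^sup>+\<close>. The factors can be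
  continued at all because \<open>G\<close> can, away from its branch points, and because at each letter one of
  the factors is left unchanged and the other one is expressed through it and \<open>G\<close>.
\<close>

section \<open>Germs\<close>

text \<open>For \<open>y \<noteq> x\<close> in the witnessing open set \<open>S\<close>, the T1
  property makes \<open>S - {x}\<close> an open neighbourhood of \<open>y\<close>; for
  \<open>y = x\<close> the assumption itself applies. This moves relations between germs to nearby
  points.\<close>

lemma eventually_at_spread:
  fixes x :: "'a::t1_space"
  assumes "eventually P (at x)"
  shows "\<forall>\<^sub>F y in nhds x. eventually P (at y)"
proof -
  obtain S where S: "open S" "x \<in> S" "\<And>z. z \<in> S \<Longrightarrow> z \<noteq> x \<Longrightarrow> P z"
    using assms unfolding eventually_at_topological by blast
  have "eventually P (at y)" if "y \<in> S" for y
  proof (cases "y = x")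
    case False
    have "open (S - {x})" using S(1) by blast
    then show ?thesis
      unfolding eventually_at_topological using False S(3) that by blast
  qed (use assms in simp)
  then show ?thesis
    using S(1,2) unfolding eventually_nhds by blast
qed

lemma germ_eq_refl [simp]: "germ_eq z F F"
  by (simp add: germ_eq_def)

lemma germ_eq_sym: "germ_eq z F H \<Longrightarrow> germ_eq z H F"
  unfolding germ_eq_def by (auto elim: eventually_mono)

lemma germ_eq_trans: "germ_eq z F H \<Longrightarrow> germ_eq z H K \<Longrightarrow> germ_eq z F K"
  unfolding germ_eq_def by (erule (1) eventually_elim2) simp

lemma germ_eq_map2:
  "germ_eq z F F' \<Longrightarrow> germ_eq z H H' \<Longrightarrow> germ_eq z (\<lambda>x. f (F x) (H x)) (\<lambda>x. f (F' x) (H' x))"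
  unfolding germ_eq_def by (erule (1) eventually_elim2) simp

lemma germ_eq_spread: "germ_eq z F H \<Longrightarrow> \<forall>\<^sub>F y in nhds z. germ_eq y F H"
  unfolding germ_eq_def by (rule eventually_at_spread)

text \<open>Local identity theorem: some entry of the difference is not identically zero near
  \<open>z\<close>, and a meromorphic function with zeros accumulating at \<open>z\<close> would be.
  So two meromorphic germs agree or differ on a whole punctured neighbourhood.\<close>

lemma meromorphic_germ_neqD:
  assumes "mat_meromorphic_on F {z}" "mat_meromorphic_on H {z}" "\<not> germ_eq z F H"
  shows "\<forall>\<^sub>F x in at z. F x \<noteq> H x"
proof -
  have "\<exists>i j. \<not> (\<forall>\<^sub>F x in at z. F x $ i $ j - H x $ i $ j = 0)"
  proof (rule ccontr)
    assume "\<not> ?thesis"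
    then have "\<forall>\<^sub>F x in at z. F x $ i $ j - H x $ i $ j = 0" for i j
      by blast
    then have "\<forall>\<^sub>F x in at z. \<forall>i j. F x $ i $ j - H x $ i $ j = 0"
      by (intro eventually_all_finite)
    then have "germ_eq z F H"
      unfolding germ_eq_def by eventually_elim (simp add: vec_eq_iff)
    then show False
      using assms(3) by contradiction
  qed
  then obtain i j where ij: "\<not> (\<forall>\<^sub>F x in at z. F x $ i $ j - H x $ i $ j = 0)"
    by blast
  have "(\<lambda>x. F x $ i $ j - H x $ i $ j) meromorphic_on {z}"
    using assms(1,2) unfolding mat_meromorphic_on_def by (intro meromorphic_on_diff) blast+
  then have "\<not> (\<exists>\<^sub>F x in at z. F x $ i $ j - H x $ i $ j = 0)"
    using ij not_essential_frequently_0_imp_eventually_0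
      meromorphic_on_isolated_singularity meromorphic_on_not_essential by blast
  then have "\<forall>\<^sub>F x in at z. F x $ i $ j - H x $ i $ j \<noteq> 0"
    by (simp add: not_frequently)
  then show ?thesis
    by eventually_elim auto
qed

lemma mat_meromorphic_onD: "mat_meromorphic_on F A \<Longrightarrow> (\<lambda>z. F z $ i $ j) meromorphic_on A"
  by (simp add: mat_meromorphic_on_def)

lemma mat_meromorphic_on_subset:
  "mat_meromorphic_on F A \<Longrightarrow> B \<subseteq> A \<Longrightarrow> mat_meromorphic_on F B"
  unfolding mat_meromorphic_on_def using meromorphic_on_subset by blast

lemma mat_analytic_except_poles_imp_meromorphic:
  "mat_analytic_except_poles F A \<Longrightarrow> mat_meromorphic_on F A"
  by (simp add: mat_analytic_except_poles_def analytic_except_poles_def mat_meromorphic_on_def)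

lemma mat_algebraic_branch_imp_meromorphic:
  "mat_algebraic_branch F A \<Longrightarrow> mat_meromorphic_on F A"
  by (simp add: mat_algebraic_branch_def algebraic_branch_def analytic_except_poles_def
      mat_meromorphic_on_def)

section \<open>Products and inverses of meromorphic matrix functions\<close>

lemma mat_meromorphic_on_mult:
  assumes "mat_meromorphic_on F A" "mat_meromorphic_on H A"
  shows "mat_meromorphic_on (\<lambda>z. F z ** H z) A"
  using assms unfolding mat_meromorphic_on_def matrix_matrix_mult_def
  by (auto intro!: meromorphic_intros)

lemma det_meromorphic_on:
  assumes "mat_meromorphic_on F A"
  shows "(\<lambda>z. det (F z)) meromorphic_on A"
  using assms unfolding mat_meromorphic_on_def det_def
  by (auto intro!: meromorphic_intros)

text \<open>
  Unlike \<^const>\<open>matrix_inv\<close>, which is unspecified at singular matrices, this is a rational function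
  of the entries, so it preserves meromorphy unconditionally.
\<close>
definition cramer_inv :: "complex^'n^'n \<Rightarrow> complex^('n::finite)^'n" where
  "cramer_inv A = (\<chi> i j. det (\<chi> r s. if s = i then axis j 1 $ r else A $ r $ s) / det A)"

lemma matrix_vector_column_axis:
  fixes A :: "'a::semiring_1^'n^'m"
  shows "A *v axis j 1 = column j A"
proof -
  have "(\<Sum>l\<in>UNIV. A $ i $ l * axis j 1 $ l) = (\<Sum>l\<in>UNIV. if l = j then A $ i $ j else 0)" for i
    by (intro sum.cong) (auto simp: axis_def)
  then show ?thesis
    by (simp add: matrix_vector_mult_def column_def)
qed

text \<open>Column \<open>j\<close> of \<open>cramer_inv A\<close> is the solution of
  \<open>A *v x = axis j 1\<close> given by Cramer's rule, so the two sides are compared column by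
  column.\<close>

lemma cramer_inv_right:
  assumes "det A \<noteq> 0"
  shows "A ** cramer_inv A = mat 1"
proof -
  have "(A ** cramer_inv A) *v axis j 1 = axis j 1" for j
  proof -
    have "cramer_inv A *v axis j 1 =
        (\<chi> i. det (\<chi> r s. if s = i then axis j 1 $ r else A $ r $ s) / det A)"
      by (simp add: matrix_vector_column_axis cramer_inv_def column_def)
    then have "A *v (cramer_inv A *v axis j 1) = axis j 1"
      using cramer[OF assms] by blast
    then show ?thesis
      by (simp add: matrix_vector_mul_assoc)
  qed
  then have "column j (A ** cramer_inv A) = column j (mat 1)" for j
    by (metis matrix_vector_column_axis matrix_vector_mul_lid)
  then show ?thesis
    by (simp add: vec_eq_iff column_def)
qed

lemma cramer_inv_left: "det A \<noteq> 0 \<Longrightarrow> cramer_inv A ** A = mat 1"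
  using cramer_inv_right matrix_left_right_inverse by blast

lemma matrix_inv_left:
  fixes A :: "'a::field^'n^('n::finite)"
  assumes "det A \<noteq> 0"
  shows "matrix_inv A ** A = mat 1"
proof -
  have "\<exists>B. A ** B = mat 1 \<and> B ** A = mat 1"
    using assms invertible_det_nz[of A] by (simp add: invertible_def)
  from someI_ex[OF this] show ?thesis
    by (simp add: matrix_inv_def)
qed

text \<open>Each entry is a quotient of determinants of meromorphic matrices. If the denominator
  vanishes identically, the convention \<open>x / 0 = 0\<close> makes the quotient zero, which is
  still meromorphic.\<close>

lemma mat_meromorphic_on_cramer_inv:
  assumes "mat_meromorphic_on F A"
  shows "mat_meromorphic_on (\<lambda>z. cramer_inv (F z)) A"
proof -
  have "mat_meromorphic_on (\<lambda>z. \<chi> r s. if s = i then axis j 1 $ r else F z $ r $ s) A" for i j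
    unfolding mat_meromorphic_on_def
  proof (intro allI)
    fix r s
    show "(\<lambda>z. (\<chi> r s. if s = i then axis j 1 $ r else F z $ r $ s) $ r $ s) meromorphic_on A"
      by (cases "s = i") (auto intro: mat_meromorphic_onD[OF assms])
  qed
  then show ?thesis
    using assms unfolding mat_meromorphic_on_def[of "\<lambda>z. cramer_inv (F z)"]
    by (auto simp: cramer_inv_def intro!: meromorphic_on_divide det_meromorphic_on)
qed

section \<open>Families of germs along a curve\<close>

text \<open>The compatibility condition of \<open>continues_along\<close> over an arbitrary
  parameter set, so that families can be restricted, reparametrized and glued.\<close>

definition germ_family ::
    "(real \<Rightarrow> complex) \<Rightarrow> real set \<Rightarrow> (real \<Rightarrow> ('n::finite) matfun) \<Rightarrow> bool" where
  "germ_family \<gamma> S \<Phi> \<longleftrightarrow>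
     (\<forall>t\<in>S. mat_meromorphic_on (\<Phi> t) {\<gamma> t}) \<and>
     (\<forall>t\<in>S. \<forall>\<^sub>F s in at t within S. germ_eq (\<gamma> s) (\<Phi> s) (\<Phi> t))"

lemma continues_along_iff:
  "continues_along \<gamma> F H \<longleftrightarrow>
     (\<exists>\<Phi>. germ_family \<gamma> {0..1} \<Phi> \<and> germ_eq (\<gamma> 0) (\<Phi> 0) F \<and> germ_eq (\<gamma> 1) (\<Phi> 1) H)"
  unfolding continues_along_def germ_family_def by (simp add: conj_assoc)

lemma germ_family_const:
  "(\<And>t. t \<in> S \<Longrightarrow> mat_meromorphic_on F {\<gamma> t}) \<Longrightarrow> germ_family \<gamma> S (\<lambda>_. F)"
  by (simp add: germ_family_def)

lemma germ_family_subset: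
  assumes "germ_family \<gamma> S \<Phi>" "T \<subseteq> S"
  shows "germ_family \<gamma> T \<Phi>"
  using assms at_le[OF assms(2)] unfolding germ_family_def
  by (meson filter_leD subsetD)

text \<open>A general operation \<open>f\<close> covers products and, by ignoring its second
  argument, inverses.\<close>

lemma germ_family_map2:
  assumes "germ_family \<gamma> S \<Phi>" "germ_family \<gamma> S \<Psi>"
    and "\<And>F H A. mat_meromorphic_on F A \<Longrightarrow> mat_meromorphic_on H A \<Longrightarrow>
           mat_meromorphic_on (\<lambda>z. f (F z) (H z)) A"
  shows "germ_family \<gamma> S (\<lambda>t z. f (\<Phi> t z) (\<Psi> t z))"
  unfolding germ_family_def
proof (intro conjI ballI)
  fix t assume t: "t \<in> S"
  show "mat_meromorphic_on (\<lambda>z. f (\<Phi> t z) (\<Psi> t z)) {\<gamma> t}"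
    using assms t unfolding germ_family_def by blast
  have "\<forall>\<^sub>F s in at t within S. germ_eq (\<gamma> s) (\<Phi> s) (\<Phi> t)"
    "\<forall>\<^sub>F s in at t within S. germ_eq (\<gamma> s) (\<Psi> s) (\<Psi> t)"
    using assms t unfolding germ_family_def by blast+
  then show "\<forall>\<^sub>F s in at t within S.
      germ_eq (\<gamma> s) (\<lambda>z. f (\<Phi> s z) (\<Psi> s z)) (\<lambda>z. f (\<Phi> t z) (\<Psi> t z))"
    by eventually_elim (rule germ_eq_map2)
qed

lemma germ_family_reparam:
  assumes "germ_family \<gamma> S \<Phi>" "continuous_on T h" "h ` T \<subseteq> S" "\<And>t. t \<in> T \<Longrightarrow> \<delta> t = \<gamma> (h t)"
  shows "germ_family \<delta> T (\<lambda>t. \<Phi> (h t))"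
  unfolding germ_family_def
proof (intro conjI ballI)
  fix t assume t: "t \<in> T"
  show "mat_meromorphic_on (\<Phi> (h t)) {\<delta> t}"
    using assms t unfolding germ_family_def by fastforce
  have ht: "h t \<in> S" using assms t by blast
  have "\<forall>\<^sub>F s in at (h t) within S. germ_eq (\<gamma> s) (\<Phi> s) (\<Phi> (h t))"
    using assms(1) ht unfolding germ_family_def by blast
  \<comment> \<open>The value \<open>h t\<close> may be taken again at \<open>s \<noteq> t\<close>,
    so a full neighbourhood of \<open>h t\<close> is needed; at the point itself the relation is
    reflexivity.\<close>
  then have "\<forall>\<^sub>F s in nhds (h t). s \<in> S \<longrightarrow> germ_eq (\<gamma> s) (\<Phi> s) (\<Phi> (h t))"
    unfolding eventually_at_filter by eventually_elim auto
  moreover have "(h \<longlongrightarrow> h t) (at t within T)"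
    using assms(2) t by (simp add: continuous_on_def)
  ultimately have "\<forall>\<^sub>F s in at t within T. h s \<in> S \<longrightarrow> germ_eq (\<gamma> (h s)) (\<Phi> (h s)) (\<Phi> (h t))"
    by (rule eventually_compose_filterlim)
  moreover have "\<forall>\<^sub>F s in at t within T. s \<in> T"
    by (simp add: eventually_at_filter)
  ultimately show "\<forall>\<^sub>F s in at t within T. germ_eq (\<delta> s) (\<Phi> (h s)) (\<Phi> (h t))"
    by eventually_elim (use assms in auto)
qed

lemma germ_eq_spread_along:
  assumes "germ_eq (\<gamma> t) F H" "continuous_on S \<gamma>" "t \<in> S"
  shows "\<forall>\<^sub>F s in at t within S. germ_eq (\<gamma> s) F H"
  using germ_eq_spread[OF assms(1)] assms(2,3)
  by (auto simp: continuous_on_def intro: eventually_compose_filterlim)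

text \<open>Away from \<open>b\<close> the filter sees only one of the two families. At
  \<open>b\<close> it is the supremum of the two one-sided filters, which are treated
  separately.\<close>

lemma germ_family_glue:
  assumes \<Phi>: "germ_family \<gamma> {a..b} \<Phi>" and \<Psi>: "germ_family \<gamma> {b..c} \<Psi>"
    and eq: "germ_eq (\<gamma> b) (\<Phi> b) (\<Psi> b)" and cont: "continuous_on {b..c} \<gamma>"
    and le: "a \<le> b" "b \<le> c"
  shows "germ_family \<gamma> {a..c} (\<lambda>t. if t \<le> b then \<Phi> t else \<Psi> t)" (is "germ_family _ _ ?\<Theta>")
  unfolding germ_family_def
proof (intro conjI ballI)
  fix t assume t: "t \<in> {a..c}"
  show "mat_meromorphic_on (?\<Theta> t) {\<gamma> t}"
    using \<Phi> \<Psi> t unfolding germ_family_def by auto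
  consider "t < b" | "t = b" | "t > b" by linarith
  then show "\<forall>\<^sub>F s in at t within {a..c}. germ_eq (\<gamma> s) (?\<Theta> s) (?\<Theta> t)"
  proof cases
    case 1
    have "at t within {a..c} = at t within {a..b}"
      by (rule at_within_nhd[where S = "{..<b}"]) (use 1 le in auto)
    moreover have "\<forall>\<^sub>F s in at t within {a..b}. germ_eq (\<gamma> s) (\<Phi> s) (\<Phi> t)"
      using \<Phi> 1 t unfolding germ_family_def by auto
    moreover have "\<forall>\<^sub>F s in at t within {a..b}. s \<in> {a..b}"
      by (simp add: eventually_at_filter)
    ultimately show ?thesis
      using 1 by (auto elim: eventually_elim2)
  next
    case 3
    have "at t within {a..c} = at t within {b..c}"
      by (rule at_within_nhd[where S = "{b<..}"]) (use 3 le in auto)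
    moreover have "\<forall>\<^sub>F s in at t within {b..c}. germ_eq (\<gamma> s) (\<Psi> s) (\<Psi> t)"
      using \<Psi> 3 t unfolding germ_family_def by auto
    moreover have "\<forall>\<^sub>F s in at t within {b..c}. s > b"
      using 3 by (intro eventually_at_in_open'[of "{b<..}", simplified, THEN filter_leD[OF at_le, rotated]]) auto
    ultimately show ?thesis
      using 3 by (auto elim: eventually_elim2)
  next
    case 2
    have "{a..c} = {a..b} \<union> {b..c}" using le by auto
    then have sup: "at t within {a..c} = sup (at b within {a..b}) (at b within {b..c})"
      using 2 by (simp add: at_within_union)
    have "\<forall>\<^sub>F s in at b within {a..b}. germ_eq (\<gamma> s) (\<Phi> s) (\<Phi> b)"
      using \<Phi> le unfolding germ_family_def by auto
    moreover have "\<forall>\<^sub>F s in at b within {a..b}. s \<in> {a..b}"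
      by (simp add: eventually_at_filter)
    ultimately have L: "\<forall>\<^sub>F s in at b within {a..b}. germ_eq (\<gamma> s) (?\<Theta> s) (?\<Theta> b)"
      by (auto elim: eventually_elim2)
    have "\<forall>\<^sub>F s in at b within {b..c}. germ_eq (\<gamma> s) (\<Psi> s) (\<Psi> b)"
      using \<Psi> le unfolding germ_family_def by auto
    \<comment> \<open>The glued family is \<open>\<Phi> b\<close> at the seam but
      \<open>\<Psi> s\<close> just after it, so the agreement at \<open>\<gamma> b\<close> has to be
      spread to nearby points of the curve.\<close>
    moreover have "\<forall>\<^sub>F s in at b within {b..c}. germ_eq (\<gamma> s) (\<Phi> b) (\<Psi> b)"
      using germ_eq_spread_along[OF eq cont] le by auto
    moreover have "\<forall>\<^sub>F s in at b within {b..c}. s > b"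
      by (auto simp: eventually_at_filter)
    ultimately have R: "\<forall>\<^sub>F s in at b within {b..c}. germ_eq (\<gamma> s) (?\<Theta> s) (?\<Theta> b)"
      by eventually_elim (auto intro: germ_eq_trans germ_eq_sym)
    show ?thesis
      unfolding sup eventually_sup using L R 2 by simp
  qed
qed

text \<open>The open-and-closed argument, used both for uniqueness of continuation and for its
  existence off the branch affixes.\<close>

lemma connected_locally_constant_pred:
  fixes S :: "'a::topological_space set"
  assumes "connected S" "x \<in> S" "y \<in> S" "P x"
    and loc: "\<And>t. t \<in> S \<Longrightarrow> \<forall>\<^sub>F s in at t within S. P s = P t"
  shows "P y"
proof (rule connected_induction_simple[where P = P, OF assms(1-4)])
  fix t assume "t \<in> S"
  from loc[OF this] obtain U where "open U" "t \<in> U" "\<And>s. s \<in> U \<Longrightarrow> s \<noteq> t \<Longrightarrow> s \<in> S \<Longrightarrow> P s = P t"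
    unfolding eventually_at_topological by blast
  then show "\<exists>T. openin (top_of_set S) T \<and> t \<in> T \<and> (\<forall>x\<in>T. \<forall>y\<in>T. P x \<longrightarrow> P y)"
    using \<open>t \<in> S\<close> by (intro exI[of _ "S \<inter> U"]) (auto simp: openin_open)
qed

text \<open>Identity theorem along a curve: whether the two germs agree is locally constant in the
  parameter, because agreement and, for meromorphic germs, disagreement both spread to nearby
  points.\<close>

lemma germ_family_unique:
  assumes \<Phi>: "germ_family \<gamma> S \<Phi>" and \<Psi>: "germ_family \<gamma> S \<Psi>"
    and cont: "continuous_on S \<gamma>" and "connected S" "x \<in> S" "y \<in> S"
    and "germ_eq (\<gamma> x) (\<Phi> x) (\<Psi> x)"
  shows "germ_eq (\<gamma> y) (\<Phi> y) (\<Psi> y)"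
proof (rule connected_locally_constant_pred[OF \<open>connected S\<close> \<open>x \<in> S\<close> \<open>y \<in> S\<close>,
      where P = "\<lambda>t. germ_eq (\<gamma> t) (\<Phi> t) (\<Psi> t)"])
  show "germ_eq (\<gamma> x) (\<Phi> x) (\<Psi> x)" by fact
  fix t assume t: "t \<in> S"
  \<comment> \<open>First the fixed representatives \<open>\<Phi> t\<close> and
    \<open>\<Psi> t\<close> are compared at nearby points; compatibility then replaces them by
    \<open>\<Phi> s\<close> and \<open>\<Psi> s\<close>.\<close>
  have same: "\<forall>\<^sub>F s in at t within S. germ_eq (\<gamma> s) (\<Phi> t) (\<Psi> t) \<longleftrightarrow> germ_eq (\<gamma> t) (\<Phi> t) (\<Psi> t)"
  proof (cases "germ_eq (\<gamma> t) (\<Phi> t) (\<Psi> t)")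
    case True
    then show ?thesis using germ_eq_spread_along[OF _ cont t] by simp
  next
    case False
    have "\<forall>\<^sub>F z in at (\<gamma> t). \<Phi> t z \<noteq> \<Psi> t z"
      using False \<Phi> \<Psi> t unfolding germ_family_def by (intro meromorphic_germ_neqD) auto
    then have "\<forall>\<^sub>F y in nhds (\<gamma> t). \<not> germ_eq y (\<Phi> t) (\<Psi> t)"
    proof (rule eventually_mono[OF eventually_at_spread])
      fix y assume ne: "\<forall>\<^sub>F z in at y. \<Phi> t z \<noteq> \<Psi> t z"
      show "\<not> germ_eq y (\<Phi> t) (\<Psi> t)"
      proof
        assume "germ_eq y (\<Phi> t) (\<Psi> t)"
        with ne have "\<forall>\<^sub>F z in at y. False"
          unfolding germ_eq_def by eventually_elim simp
        then show False by simp
      qed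
    qed
    then have "\<forall>\<^sub>F s in at t within S. \<not> germ_eq (\<gamma> s) (\<Phi> t) (\<Psi> t)"
      using cont t by (auto simp: continuous_on_def intro: eventually_compose_filterlim)
    then show ?thesis using False by simp
  qed
  have "\<forall>\<^sub>F s in at t within S. germ_eq (\<gamma> s) (\<Phi> s) (\<Phi> t)"
    "\<forall>\<^sub>F s in at t within S. germ_eq (\<gamma> s) (\<Psi> s) (\<Psi> t)"
    using \<Phi> \<Psi> t unfolding germ_family_def by blast+
  with same show "\<forall>\<^sub>F s in at t within S.
      germ_eq (\<gamma> s) (\<Phi> s) (\<Psi> s) = germ_eq (\<gamma> t) (\<Phi> t) (\<Psi> t)"
    by eventually_elim (meson germ_eq_sym germ_eq_trans)
qed

section \<open>Continuation along paths\<close>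

lemma continues_along_unique:
  assumes "continues_along \<gamma> F H" "continues_along \<gamma> F' H'" "path \<gamma>"
    and "germ_eq (pathstart \<gamma>) F F'"
  shows "germ_eq (pathfinish \<gamma>) H H'"
proof -
  obtain \<Phi> \<Psi> where *: "germ_family \<gamma> {0..1} \<Phi>" "germ_eq (\<gamma> 0) (\<Phi> 0) F" "germ_eq (\<gamma> 1) (\<Phi> 1) H"
    "germ_family \<gamma> {0..1} \<Psi>" "germ_eq (\<gamma> 0) (\<Psi> 0) F'" "germ_eq (\<gamma> 1) (\<Psi> 1) H'"
    using assms unfolding continues_along_iff by blast
  have "germ_eq (\<gamma> 0) (\<Phi> 0) (\<Psi> 0)"
    using * assms(4) unfolding pathstart_def by (meson germ_eq_sym germ_eq_trans)
  then have "germ_eq (\<gamma> 1) (\<Phi> 1) (\<Psi> 1)"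
    using germ_family_unique[OF *(1,4), of 0 1] \<open>path \<gamma>\<close> by (auto simp: path_def)
  then show ?thesis
    using * unfolding pathfinish_def by (meson germ_eq_sym germ_eq_trans)
qed

text \<open>The constant family is a witness. On a bypass inside its half-plane of meromorphy, a
  factor therefore returns unchanged.\<close>

lemma continues_along_refl:
  "mat_meromorphic_on F (path_image \<gamma>) \<Longrightarrow> continues_along \<gamma> F F"
  unfolding continues_along_iff
  by (intro exI[of _ "\<lambda>_. F"])
    (auto intro!: germ_family_const elim!: mat_meromorphic_on_subset simp: path_image_def)

lemma continues_along_map2:
  assumes "continues_along \<gamma> F H" "continues_along \<gamma> F' H'"
    and "\<And>F H A. mat_meromorphic_on F A \<Longrightarrow> mat_meromorphic_on H A \<Longrightarrow>
           mat_meromorphic_on (\<lambda>z. f (F z) (H z)) A"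
  shows "continues_along \<gamma> (\<lambda>z. f (F z) (F' z)) (\<lambda>z. f (H z) (H' z))"
proof -
  obtain \<Phi> \<Psi> where *: "germ_family \<gamma> {0..1} \<Phi>" "germ_eq (\<gamma> 0) (\<Phi> 0) F" "germ_eq (\<gamma> 1) (\<Phi> 1) H"
    "germ_family \<gamma> {0..1} \<Psi>" "germ_eq (\<gamma> 0) (\<Psi> 0) F'" "germ_eq (\<gamma> 1) (\<Psi> 1) H'"
    using assms unfolding continues_along_iff by blast
  show ?thesis
    unfolding continues_along_iff
  proof (intro exI conjI)
    show "germ_family \<gamma> {0..1} (\<lambda>t z. f (\<Phi> t z) (\<Psi> t z))"
      by (rule germ_family_map2[OF *(1,4) assms(3)])
    show "germ_eq (\<gamma> 0) (\<lambda>z. f (\<Phi> 0 z) (\<Psi> 0 z)) (\<lambda>z. f (F z) (F' z))"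
      by (rule germ_eq_map2[OF *(2,5)])
    show "germ_eq (\<gamma> 1) (\<lambda>z. f (\<Phi> 1 z) (\<Psi> 1 z)) (\<lambda>z. f (H z) (H' z))"
      by (rule germ_eq_map2[OF *(3,6)])
  qed
qed

lemma continues_along_mult:
  assumes "continues_along \<gamma> F H" "continues_along \<gamma> F' H'"
  shows "continues_along \<gamma> (\<lambda>z. F z ** F' z) (\<lambda>z. H z ** H' z)"
  using assms by (rule continues_along_map2) (rule mat_meromorphic_on_mult)

lemma continues_along_cramer_inv:
  assumes "continues_along \<gamma> F H"
  shows "continues_along \<gamma> (\<lambda>z. cramer_inv (F z)) (\<lambda>z. cramer_inv (H z))"
  by (rule continues_along_map2[OF assms assms, where f = "\<lambda>A _. cramer_inv A"])
    (rule mat_meromorphic_on_cramer_inv)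

lemma continues_along_start_cong:
  "continues_along \<gamma> F H \<Longrightarrow> germ_eq (pathstart \<gamma>) F F' \<Longrightarrow> continues_along \<gamma> F' H"
  unfolding continues_along_iff pathstart_def by (meson germ_eq_trans)

text \<open>The two families, run at double speed, are glued at \<open>1/2\<close>, where both
  represent the germ of \<open>H\<close>.\<close>

lemma continues_along_join:
  assumes "continues_along \<gamma> F H" "continues_along \<delta> H K" "path \<gamma>" "path \<delta>"
    and "pathfinish \<gamma> = pathstart \<delta>"
  shows "continues_along (\<gamma> +++ \<delta>) F K"
proof -
  have eq: "\<gamma> 1 = \<delta> 0"
    using assms(5) by (simp add: pathfinish_def pathstart_def)
  obtain \<Phi> \<Psi> where *: "germ_family \<gamma> {0..1} \<Phi>" "germ_eq (\<gamma> 0) (\<Phi> 0) F" "germ_eq (\<gamma> 1) (\<Phi> 1) H"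
    "germ_family \<delta> {0..1} \<Psi>" "germ_eq (\<delta> 0) (\<Psi> 0) H" "germ_eq (\<delta> 1) (\<Psi> 1) K"
    using assms unfolding continues_along_iff by blast
  have 1: "germ_family (\<gamma> +++ \<delta>) {0..1/2} (\<lambda>t. \<Phi> (2 * t))"
    by (rule germ_family_reparam[OF *(1)]) (auto intro!: continuous_intros simp: joinpaths_def)
  \<comment> \<open>At \<open>1/2\<close> the joined path is defined by its left half, so this value
    needs the matching endpoints.\<close>
  have right: "(\<gamma> +++ \<delta>) t = \<delta> (2 * t - 1)" if "1/2 \<le> t" for t
  proof (cases "t = 1/2")
    case True
    show ?thesis unfolding True by (simp add: joinpaths_def eq)
  qed (use that in \<open>auto simp: joinpaths_def\<close>)
  have 2: "germ_family (\<gamma> +++ \<delta>) {1/2..1} (\<lambda>t. \<Psi> (2 * t - 1))"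
    by (rule germ_family_reparam[OF *(4)])
      (auto intro!: continuous_intros simp: right)
  have "path (\<gamma> +++ \<delta>)" using assms by simp
  then have "continuous_on {1/2..1} (\<gamma> +++ \<delta>)"
    unfolding path_def by (rule continuous_on_subset) auto
  moreover have "germ_eq ((\<gamma> +++ \<delta>) (1/2)) (\<Phi> (2 * (1/2))) (\<Psi> (2 * (1/2) - 1))"
    using *(3,5) by (auto simp: joinpaths_def eq intro: germ_eq_trans germ_eq_sym)
  ultimately have "germ_family (\<gamma> +++ \<delta>) {0..1}
      (\<lambda>t. if t \<le> 1/2 then \<Phi> (2 * t) else \<Psi> (2 * t - 1))"
    using germ_family_glue[OF 1 2] by auto
  then show ?thesis
    unfolding continues_along_iff using *(2,6)
    by (intro exI conjI) (assumption, auto simp: joinpaths_def)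
qed

lemma continuation_continues_along:
  "continuable \<gamma> F \<Longrightarrow> continues_along \<gamma> F (continuation \<gamma> F)"
  unfolding continuable_def continuation_def by (rule someI_ex[of "continues_along \<gamma> F"])

text \<open>Being continuable up to parameter \<open>T\<close> is locally constant in
  \<open>T\<close>. The disc about \<open>c T\<close> given by the absence of a branch point serves
  all branches at once, so its radius does not depend on how far the continuation has already
  come.\<close>

lemma continuable_avoiding_branch_affixes:
  assumes "path c" "pathstart c \<in> A" "mat_meromorphic_on G A"
    and avoid: "\<And>p. p \<in> path_image c \<Longrightarrow> \<not> branch_affix A G p"
  shows "continuable c G"
proof -
  define Q where "Q T \<longleftrightarrow> (\<exists>\<Phi>. germ_family c {0..T} \<Phi> \<and> germ_eq (c 0) (\<Phi> 0) G)" for T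
  have cont: "continuous_on {0..1} c" using assms(1) by (simp add: path_def)
  have mono: "Q s" if "Q t" "s \<le> t" for s t
    using that germ_family_subset[of c "{0..t}" _ "{0..s}"] unfolding Q_def by fastforce
  have "Q 1"
  proof (rule connected_locally_constant_pred[where S = "{0..1::real}" and P = Q])
    have "mat_meromorphic_on G {c 0}"
      using assms(2,3) by (auto simp: pathstart_def intro: mat_meromorphic_on_subset)
    then show "Q 0"
      unfolding Q_def by (intro exI[of _ "\<lambda>_. G"]) (auto intro!: germ_family_const)
    fix T :: real assume T: "T \<in> {0..1}"
    then have "\<not> branch_affix A G (c T)"
      by (intro avoid) (simp add: path_image_def)
    then obtain r where r: "r > 0" and
      ext: "\<And>\<gamma> H. path \<gamma> \<Longrightarrow> pathstart \<gamma> \<in> A \<Longrightarrow> pathfinish \<gamma> \<in> ball (c T) r \<Longrightarrow>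
        continues_along \<gamma> G H \<Longrightarrow>
        \<exists>B. mat_meromorphic_on B (ball (c T) r) \<and> germ_eq (pathfinish \<gamma>) B H"
      unfolding branch_affix_def by blast
    have step: "Q t" if "Q s" "0 \<le> s" "s \<le> t" "t \<le> 1" and sub: "c ` {s..t} \<subseteq> ball (c T) r" for s t
    proof -
      obtain \<Phi> where \<Phi>: "germ_family c {0..s} \<Phi>" "germ_eq (c 0) (\<Phi> 0) G"
        using \<open>Q s\<close> unfolding Q_def by blast
      \<comment> \<open>The initial piece of \<open>c\<close> up to \<open>s\<close> is rescaled to
        \<open>{0..1}\<close>, as \<open>branch_affix\<close> speaks of full paths starting in
        \<open>A\<close>. The function \<open>B\<close> found on the disc then carries the germ on
        from \<open>s\<close> to \<open>t\<close>.\<close>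
      define \<gamma> where "\<gamma> u = c (s * u)" for u
      have img: "(*) s ` {0..1} \<subseteq> {0..s}"
        using that by (auto simp: mult_left_le)
      have "path \<gamma>"
        unfolding path_def \<gamma>_def
        by (rule continuous_on_compose2[OF cont])
          (use img that in \<open>auto intro!: continuous_intros\<close>)
      moreover have "c s \<in> ball (c T) r"
        using that by (intro subsetD[OF sub]) auto
      then have "pathstart \<gamma> \<in> A" "pathfinish \<gamma> \<in> ball (c T) r" "pathfinish \<gamma> = c s"
        using assms(2) by (auto simp: pathstart_def pathfinish_def \<gamma>_def)
      moreover have "germ_family \<gamma> {0..1} (\<lambda>u. \<Phi> (s * u))"
        by (rule germ_family_reparam[OF \<Phi>(1)])
          (use img in \<open>auto intro!: continuous_intros simp: \<gamma>_def\<close>)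
      then have "continues_along \<gamma> G (\<Phi> s)"
        unfolding continues_along_iff using \<Phi>(2)
        by (intro exI[of _ "\<lambda>u. \<Phi> (s * u)"]) (auto simp: \<gamma>_def)
      ultimately obtain B where B: "mat_meromorphic_on B (ball (c T) r)" "germ_eq (c s) B (\<Phi> s)"
        using ext by metis
      have "germ_family c {s..t} (\<lambda>_. B)"
        by (intro germ_family_const mat_meromorphic_on_subset[OF B(1)]) (use sub in blast)
      moreover have "continuous_on {s..t} c"
        using that by (intro continuous_on_subset[OF cont]) auto
      ultimately have "germ_family c {0..t} (\<lambda>u. if u \<le> s then \<Phi> u else B)"
        using germ_family_glue[OF \<Phi>(1) _ germ_eq_sym[OF B(2)]] that by blast
      then show "Q t"
        unfolding Q_def using \<Phi>(2) \<open>0 \<le> s\<close> by (intro exI conjI) (assumption, simp)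
    qed
    obtain d where d: "d > 0" "\<And>u. u \<in> {0..1} \<Longrightarrow> dist u T < d \<Longrightarrow> dist (c u) (c T) < r"
      using cont T r unfolding continuous_on_iff by metis
    have "Q s = Q T" if s: "s \<in> {0..1}" "dist s T < d" for s
    proof -
      \<comment> \<open>One of the two segments is empty or a single point. The other lies in the
        disc, so \<open>step\<close> carries \<open>Q\<close> to the larger parameter, and
        \<open>mono\<close> gives the way back.\<close>
      have seg: "c ` {s..T} \<subseteq> ball (c T) r" "c ` {T..s} \<subseteq> ball (c T) r"
        using d(2) s T by (auto simp: dist_commute dist_real_def)
      show ?thesis
        using step[OF _ _ _ _ seg(1)] step[OF _ _ _ _ seg(2)] mono s T by fastforce
    qed
    then show "\<forall>\<^sub>F s in at T within {0..1}. Q s = Q T"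
      unfolding eventually_at using d(1) by blast
  qed auto
  then show ?thesis
    unfolding Q_def continuable_def continues_along_iff using germ_eq_refl by blast
qed

text \<open>An identity between germs persists under continuation: both sides continue along the
  same path, and the result is unique.\<close>

lemma continues_along_factorization:
  assumes "path c" "pathstart c = z" "pathfinish c = z"
    and cont: "continues_along c G g" "continues_along c P p" "continues_along c M m"
    and G: "germ_eq z G (\<lambda>x. P x ** M x)" and det: "\<forall>\<^sub>F x in at z. det (G x) \<noteq> 0"
  shows "\<forall>\<^sub>F x in at z. g x = p x ** m x \<and> det (g x) \<noteq> 0"
proof -
  have "germ_eq z g (\<lambda>x. p x ** m x)"
    using continues_along_unique[OF cont(1) continues_along_mult[OF cont(2,3)] assms(1)] G assms(2,3)
    by simp
  \<comment> \<open>Nonvanishing of the determinant is not an identity, so it is continued in the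
    form of this one; the constant \<open>mat 1\<close> continues to itself.\<close>
  moreover have "germ_eq z (\<lambda>x. cramer_inv (G x) ** G x) (\<lambda>_. mat 1)"
    using det unfolding germ_eq_def by eventually_elim (rule cramer_inv_left)
  moreover have "mat_meromorphic_on (\<lambda>_. mat 1) (path_image c)"
    by (auto simp: mat_meromorphic_on_def)
  ultimately have "germ_eq z g (\<lambda>x. p x ** m x)"
    "germ_eq z (\<lambda>x. cramer_inv (g x) ** g x) (\<lambda>_. mat 1)"
    using continues_along_unique[OF continues_along_mult[OF continues_along_cramer_inv[OF cont(1)] cont(1)]
        continues_along_refl assms(1)] assms(2,3) by simp_all
  then show ?thesis
    unfolding germ_eq_def
    by eventually_elim (metis invertible_left_inverse invertible_det_nz)
qed

text \<open>The encircled affix is missed because the winding number is taken about it; every other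
  affix lies on its own cut, which belongs to the forbidden set.\<close>

lemma is_bypass_avoids:
  assumes bp: "is_bypass U k (\<tau> i) C ((\<Union>j\<in>I - {i}. D j) \<union> (\<Union>j\<in>J. E j)) c"
    and p: "p \<in> path_image c"
    and "\<And>j. j \<in> I \<Longrightarrow> \<tau> j \<in> D j" "\<And>j. j \<in> J \<Longrightarrow> \<sigma> j \<in> E j"
  shows "p \<notin> \<tau> ` I \<union> \<sigma> ` J"
proof -
  have "p \<noteq> \<tau> i" "p \<notin> (\<Union>j\<in>I - {i}. D j)" "p \<notin> (\<Union>j\<in>J. E j)"
    using bp p unfolding is_bypass_def by blast+
  then show ?thesis
    using assms(3,4) by blast
qed

text \<open>A one-sided inverse of a square matrix is two-sided, so
  \<open>m ** matrix_inv g ** p = mat 1\<close>. In the application \<open>g\<close>,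
  \<open>p\<close>, \<open>m\<close> belong to the truncated word and \<open>p' ** m\<close> is
  \<open>G\<close> at the longer word, whose right factor is the same.\<close>

lemma transfer_left_factor:
  fixes p m p' g :: "'a::field^'n^('n::finite)"
  assumes "det g \<noteq> 0" "g = p ** m"
  shows "(p' ** m) ** matrix_inv g ** p = p'"
proof -
  have "matrix_inv g ** p ** m = mat 1"
    using matrix_inv_left[OF assms(1)] assms(2) by (simp add: matrix_mul_assoc)
  then have "m ** (matrix_inv g ** p) = mat 1"
    by (simp add: matrix_left_right_inverse)
  then have "p' ** (m ** (matrix_inv g ** p)) = p'"
    by simp
  then show ?thesis
    by (simp add: matrix_mul_assoc)
qed

text \<open>The mirror image: now the left factor \<open>p\<close> is shared by the two
  words.\<close>

lemma transfer_right_factor: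
  fixes p m m' g :: "'a::field^'n^('n::finite)"
  assumes "det g \<noteq> 0" "g = p ** m"
  shows "m ** matrix_inv g ** (p ** m') = m'"
proof -
  have "g ** matrix_inv g = mat 1"
    using matrix_inv_left[OF assms(1)] by (simp add: matrix_left_right_inverse)
  then have "p ** (m ** matrix_inv g) = mat 1"
    using assms(2) by (simp add: matrix_mul_assoc)
  then have "(m ** matrix_inv g) ** p = mat 1"
    by (simp add: matrix_left_right_inverse)
  then show ?thesis
    by (simp add: matrix_mul_assoc)
qed

theorem theorem1:
  fixes G Qp Qm :: "('n::finite) matfun"
    and \<epsilon> :: real
    and Mp Mm :: nat
    and \<tau>p \<tau>m :: "nat \<Rightarrow> complex"
    and \<gamma>p \<gamma>m :: "nat \<Rightarrow> real \<Rightarrow> complex"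
    and k :: complex
    and a b :: "nat \<Rightarrow> real \<Rightarrow> complex"
  assumes "\<epsilon> > 0"
    and "mat_algebraic_branch G (strip \<epsilon>)"
    and "\<not> (\<forall>\<^sub>\<approx>z\<in>strip \<epsilon>. det (G z) = 0)"
    and "{p. branch_affix (strip \<epsilon>) G p} = \<tau>p ` {..<Mp} \<union> \<tau>m ` {..<Mm}"
    and "\<And>m. m < Mp \<Longrightarrow> Im (\<tau>p m) > 0 \<and> \<tau>p m \<notin> strip \<epsilon>"
    and "\<And>m. m < Mm \<Longrightarrow> Im (\<tau>m m) < 0 \<and> \<tau>m m \<notin> strip \<epsilon>"
    and "factorization_solution \<epsilon> G Qp Qm"
    and "\<And>m. m < Mp \<Longrightarrow> cut_to_infinity (\<tau>p m) (\<gamma>p m) \<and> \<gamma>p m ` {0..} \<subseteq> {z. Im z > 0}"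
    and "\<And>m. m < Mm \<Longrightarrow> cut_to_infinity (\<tau>m m) (\<gamma>m m) \<and> \<gamma>m m ` {0..} \<subseteq> {z. Im z < 0}"
    and "disjoint_family_on (\<lambda>m. \<gamma>p m ` {0..}) {..<Mp}"
    and "disjoint_family_on (\<lambda>m. \<gamma>m m ` {0..}) {..<Mm}"
    and "k \<in> strip \<epsilon>"
    and "\<And>i. i < Mp \<Longrightarrow>
           is_bypass (upper_half \<epsilon>) k (\<tau>p i) (\<gamma>p i ` {0..})
             ((\<Union>j\<in>{..<Mp} - {i}. \<gamma>p j ` {0..}) \<union> (\<Union>j<Mm. \<gamma>m j ` {0..})) (a i)"
    and "\<And>i. i < Mm \<Longrightarrow>
           is_bypass (lower_half \<epsilon>) k (\<tau>m i) (\<gamma>m i ` {0..})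
             ((\<Union>j\<in>{..<Mm} - {i}. \<gamma>m j ` {0..}) \<union> (\<Union>j<Mp. \<gamma>p j ` {0..})) (b i)"
  shows "\<forall>w \<in> bypass_words Mp Mm.
           (\<forall>F \<in> {G, Qp, Qm}. continuable (word_path k a b w) F) \<and>
           germ_eq k (continued k a b Qp w)
             (\<lambda>z. continued k a b G (trunc_plus w) z
                ** matrix_inv (continued k a b G (trunc_minus (trunc_plus w)) z)
                ** continued k a b Qp (trunc_minus (trunc_plus w)) z) \<and>
           germ_eq k (continued k a b Qm w)
             (\<lambda>z. continued k a b Qm (trunc_plus (trunc_minus w)) z
                ** matrix_inv (continued k a b G (trunc_plus (trunc_minus w)) z)
                ** continued k a b G (trunc_minus w) z)"
proof -

  \<comment> \<open>Meromorphy, factorization and invertibility at the base point\<close>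
  define S where "S = strip \<epsilon>"
  let ?W = "bypass_words Mp Mm"
  let ?c = "word_path k a b"
  have S: "open S" "connected S" "k \<in> S"
  proof -
    have *: "S = {z. Im z > -\<epsilon>} \<inter> {z. Im z < \<epsilon>}" by (auto simp: S_def strip_def)
    show "open S" unfolding * by (intro open_Int open_halfspace_Im_gt open_halfspace_Im_lt)
    show "connected S" unfolding *
      by (intro convex_connected convex_Int convex_halfspace_Im_gt convex_halfspace_Im_lt)
    show "k \<in> S" using assms(12) by (simp add: S_def)
  qed
  have mero: "mat_meromorphic_on G S" "mat_meromorphic_on Qp (upper_half \<epsilon>)"
    "mat_meromorphic_on Qm (lower_half \<epsilon>)"
    using assms(2,7) unfolding factorization_solution_def S_def
    by (auto intro: mat_algebraic_branch_imp_meromorphic mat_analytic_except_poles_imp_meromorphic)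
  have half: "k \<in> upper_half \<epsilon>" "k \<in> lower_half \<epsilon>"
    using S(3) by (auto simp: S_def strip_def upper_half_def lower_half_def)
  have G: "germ_eq k G (\<lambda>z. Qp z ** Qm z)"
    using assms(7) S unfolding factorization_solution_def germ_eq_def S_def
    by (auto intro: eventually_cosparse_imp_eventually_at)
  \<comment> \<open>On the connected strip the meromorphic determinant either vanishes off a sparse
    set, which is excluded, or is nonzero off a sparse set.\<close>
  have det: "\<forall>\<^sub>F z in at k. det (G z) \<noteq> 0"
    using meromorphic_imp_constant_or_avoid[OF det_meromorphic_on[OF mero(1)] S(1,2)] assms(3) S(3)
    by (auto simp: S_def intro: eventually_cosparse_imp_eventually_at)

  \<comment> \<open>Bypasses and branch affixes\<close>
  have a: "path (a i)" "pathstart (a i) = k" "pathfinish (a i) = k"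
    "path_image (a i) \<subseteq> upper_half \<epsilon>" if "i < Mp" for i
    using assms(13)[OF that] unfolding is_bypass_def by simp_all
  have b: "path (b i)" "pathstart (b i) = k" "pathfinish (b i) = k"
    "path_image (b i) \<subseteq> lower_half \<epsilon>" if "i < Mm" for i
    using assms(14)[OF that] unfolding is_bypass_def by simp_all
  have cutp: "\<tau>p j \<in> \<gamma>p j ` {0..}" if "j < Mp" for j
    using assms(8)[OF that] by (force simp: cut_to_infinity_def)
  have cutm: "\<tau>m j \<in> \<gamma>m j ` {0..}" if "j < Mm" for j
    using assms(9)[OF that] by (force simp: cut_to_infinity_def)
  have affix: "branch_affix S G p \<longleftrightarrow> p \<in> \<tau>p ` {..<Mp} \<union> \<tau>m ` {..<Mm}" for p
    unfolding S_def assms(4)[symmetric] by simp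
  have nb_a: "\<not> branch_affix S G p" if "i < Mp" "p \<in> path_image (a i)" for i p
  proof -
    have "p \<notin> \<tau>p ` {..<Mp} \<union> \<tau>m ` {..<Mm}"
      by (rule is_bypass_avoids[where \<tau> = \<tau>p and D = "\<lambda>j. \<gamma>p j ` {0..}" and E = "\<lambda>j. \<gamma>m j ` {0..}",
            OF assms(13)[OF that(1)] that(2)]) (simp_all add: cutp cutm)
    then show ?thesis using affix by blast
  qed
  have nb_b: "\<not> branch_affix S G p" if "i < Mm" "p \<in> path_image (b i)" for i p
  proof -
    have "p \<notin> \<tau>m ` {..<Mm} \<union> \<tau>p ` {..<Mp}"
      by (rule is_bypass_avoids[where \<tau> = \<tau>m and D = "\<lambda>j. \<gamma>m j ` {0..}" and E = "\<lambda>j. \<gamma>p j ` {0..}",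
            OF assms(14)[OF that(1)] that(2)]) (simp_all add: cutp cutm)
    then show ?thesis using affix by blast
  qed
  \<comment> \<open>The empty word is the constant path at \<open>k\<close>, which has to avoid the
    affixes too; they lie outside the strip.\<close>
  have nb_k: "\<not> branch_affix S G k"
    unfolding affix using assms(5,6,12) by blast

  \<comment> \<open>Continuation along word paths\<close>
  have wp: "path (?c w) \<and> pathstart (?c w) = k \<and> pathfinish (?c w) = k \<and>
      (\<forall>p \<in> path_image (?c w). \<not> branch_affix S G p)" if "w \<in> ?W" for w
    using that unfolding bypass_words_def
  proof (induction w rule: lists.induct)
    case Nil
    then show ?case using nb_k by (simp add: path_def pathstart_def pathfinish_def)
  next
    case (Cons x w)
    show ?case
    proof (cases x)
      case (La i)
      with Cons.hyps have "i < Mp" by auto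
      with La show ?thesis
        using a[of i] nb_a[of i] Cons.IH by (auto simp: path_image_join)
    next
      case (Lb i)
      with Cons.hyps have "i < Mm" by auto
      with Lb show ?thesis
        using b[of i] nb_b[of i] Cons.IH by (auto simp: path_image_join)
    qed
  qed
  have contG: "continuable (?c w) G" if "w \<in> ?W" for w
    using wp[OF that] S(3) mero(1) by (intro continuable_avoiding_branch_affixes[of _ S]) auto
  \<comment> \<open>The first letter is performed while \<open>Qp\<close> still has its physical
    germ, which is meromorphic along all of \<open>a i\<close>. This is why letters are dropped from
    the front of a word.\<close>
  have step_a: "continues_along (?c (La i # w)) Qp p"
    if "continues_along (?c w) Qp p" "i < Mp" "w \<in> ?W" for i w p
    using continues_along_join[OF continues_along_refl that(1)] a[OF that(2)] wp[OF that(3)]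
      mat_meromorphic_on_subset[OF mero(2)] by auto
  have step_b: "continues_along (?c (Lb i # w)) Qm m"
    if "continues_along (?c w) Qm m" "i < Mm" "w \<in> ?W" for i w m
    using continues_along_join[OF continues_along_refl that(1)] b[OF that(2)] wp[OF that(3)]
      mat_meromorphic_on_subset[OF mero(3)] by auto

  have Gnz: "\<forall>\<^sub>F z in at k. G z = Qp z ** Qm z \<and> det (Qp z) \<noteq> 0 \<and> det (Qm z) \<noteq> 0"
    using G det unfolding germ_eq_def by eventually_elim (auto simp: det_mul)
  \<comment> \<open>Each factor is expressed through \<open>G\<close> and the other factor, so that
    it can be continued wherever those two can.\<close>
  have Qm_eq: "germ_eq k (\<lambda>z. cramer_inv (Qp z) ** G z) Qm"
    using Gnz unfolding germ_eq_def
    by eventually_elim (simp add: matrix_mul_assoc cramer_inv_left)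
  have Qp_eq: "germ_eq k (\<lambda>z. G z ** cramer_inv (Qm z)) Qp"
    using Gnz unfolding germ_eq_def
    by eventually_elim (simp add: cramer_inv_right flip: matrix_mul_assoc)

  \<comment> \<open>Induction on the first letter: it leaves one factor unchanged, so that factor
    continues by the induction hypothesis; the other is then recovered from it and
    \<open>G\<close>.\<close>
  have contQ: "continuable (?c w) Qp \<and> continuable (?c w) Qm" if "w \<in> ?W" for w
    using that unfolding bypass_words_def
  proof (induction w rule: lists.induct)
    case Nil
    have "mat_meromorphic_on Qp {k}" "mat_meromorphic_on Qm {k}"
      using mero half by (auto intro: mat_meromorphic_on_subset)
    then show ?case unfolding continuable_def
      by (auto intro!: exI continues_along_refl)
  next
    case (Cons x w)
    then have w: "w \<in> ?W" "x # w \<in> ?W" by (auto simp: bypass_words_def)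
    obtain g where g: "continues_along (?c (x # w)) G g"
      using contG[OF w(2)] unfolding continuable_def by blast
    have start: "pathstart (?c (x # w)) = k" using wp[OF w(2)] by blast
    show ?case
    proof (cases x)
      case (La i)
      with w have "i < Mp" by (auto simp: bypass_words_def)
      with Cons.IH step_a w(1) La obtain p where p: "continues_along (?c (x # w)) Qp p"
        unfolding continuable_def by blast
      then have "continues_along (?c (x # w)) Qm (\<lambda>z. cramer_inv (p z) ** g z)"
        using continues_along_start_cong[OF continues_along_mult[OF continues_along_cramer_inv[OF p] g]]
          Qm_eq start by simp
      with p show ?thesis unfolding continuable_def by blast
    next
      case (Lb i)
      with w have "i < Mm" by (auto simp: bypass_words_def)
      with Cons.IH step_b w(1) Lb obtain m where m: "continues_along (?c (x # w)) Qm m"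
        unfolding continuable_def by blast
      then have "continues_along (?c (x # w)) Qp (\<lambda>z. g z ** cramer_inv (m z))"
        using continues_along_start_cong[OF continues_along_mult[OF g continues_along_cramer_inv[OF m]]]
          Qp_eq start by simp
      with m show ?thesis unfolding continuable_def by blast
    qed
  qed

  \<comment> \<open>Truncation and the two relations\<close>
  define g p m where "g = continued k a b G" and "p = continued k a b Qp" and "m = continued k a b Qm"
  have cont: "continues_along (?c w) G (g w)" "continues_along (?c w) Qp (p w)"
    "continues_along (?c w) Qm (m w)" if "w \<in> ?W" for w
    using contG[OF that] contQ[OF that] unfolding g_def p_def m_def continued_def
    by (auto intro: continuation_continues_along)
  have fact: "\<forall>\<^sub>F z in at k. g w z = p w z ** m w z \<and> det (g w z) \<noteq> 0" if "w \<in> ?W" for w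
    using continues_along_factorization[OF _ _ _ cont[OF that] G det] wp[OF that] by blast
  have tp: "trunc_plus w \<in> ?W" and tm: "trunc_minus w \<in> ?W" if "w \<in> ?W" for w
    using that unfolding bypass_words_def trunc_plus_def trunc_minus_def
    by (auto simp: in_lists_conv_set dest: set_dropWhileD)
  \<comment> \<open>A leading \<open>La i\<close> does not change the continued germ, by uniqueness;
    at a leading \<open>Lb i\<close>, truncation stops and both sides coincide.\<close>
  have p_trunc: "germ_eq k (p w) (p (trunc_plus w))" if "w \<in> ?W" for w
    using that unfolding bypass_words_def
  proof (induction w rule: lists.induct)
    case Nil
    then show ?case by (simp add: trunc_plus_def)
  next
    case (Cons x w)
    then have w: "w \<in> ?W" "x # w \<in> ?W" by (auto simp: bypass_words_def)
    show ?case
    proof (cases x)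
      case (La i)
      with w have "i < Mp" by (auto simp: bypass_words_def)
      then have "continues_along (?c (x # w)) Qp (p w)"
        using step_a cont(2) w(1) La by blast
      then have "germ_eq k (p (x # w)) (p w)"
        using continues_along_unique[OF cont(2)[OF w(2)]] wp[OF w(2)] by fastforce
      then show ?thesis using Cons.IH La by (auto simp: trunc_plus_def intro: germ_eq_trans)
    qed (simp add: trunc_plus_def)
  qed
  have m_trunc: "germ_eq k (m w) (m (trunc_minus w))" if "w \<in> ?W" for w
    using that unfolding bypass_words_def
  proof (induction w rule: lists.induct)
    case Nil
    then show ?case by (simp add: trunc_minus_def)
  next
    case (Cons x w)
    then have w: "w \<in> ?W" "x # w \<in> ?W" by (auto simp: bypass_words_def)
    show ?case
    proof (cases x)
      case (Lb i)
      with w have "i < Mm" by (auto simp: bypass_words_def)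
      then have "continues_along (?c (x # w)) Qm (m w)"
        using step_b cont(3) w(1) Lb by blast
      then have "germ_eq k (m (x # w)) (m w)"
        using continues_along_unique[OF cont(3)[OF w(2)]] wp[OF w(2)] by fastforce
      then show ?thesis using Cons.IH Lb by (auto simp: trunc_minus_def intro: germ_eq_trans)
    qed (simp add: trunc_minus_def)
  qed

  \<comment> \<open>With \<open>v = trunc_plus w\<close> and \<open>u = trunc_minus v\<close>:
    \<open>p w\<close> equals \<open>p v\<close>, and \<open>g v = p v ** m v = p v ** m u\<close>.
    Then \<open>g u = p u ** m u\<close> allows \<open>m u\<close> to be eliminated.\<close>
  have "germ_eq k (p w) (\<lambda>z. g (trunc_plus w) z ** matrix_inv (g (trunc_minus (trunc_plus w)) z)
      ** p (trunc_minus (trunc_plus w)) z)" if "w \<in> ?W" for w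
    using p_trunc[OF that] m_trunc[OF tp[OF that]] fact[OF tp[OF that]] fact[OF tm[OF tp[OF that]]]
    unfolding germ_eq_def by eventually_elim (metis transfer_left_factor)
  \<comment> \<open>Symmetrically, with \<open>v = trunc_minus w\<close> and
    \<open>u = trunc_plus v\<close>, the common left factor \<open>p u\<close> of \<open>g v\<close>
    and \<open>g u\<close> is eliminated.\<close>
  moreover have "germ_eq k (m w) (\<lambda>z. m (trunc_plus (trunc_minus w)) z
      ** matrix_inv (g (trunc_plus (trunc_minus w)) z) ** g (trunc_minus w) z)" if "w \<in> ?W" for w
    using m_trunc[OF that] p_trunc[OF tm[OF that]] fact[OF tm[OF that]] fact[OF tp[OF tm[OF that]]]
    unfolding germ_eq_def by eventually_elim (metis transfer_right_factor)
  ultimately show ?thesis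
    using contG contQ unfolding g_def p_def m_def by blast
qed

end
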